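(* Let $\mathbf{B}=(B,\wedge,\vee,\odot,\to,0,1)$ be a finite MTL-chain. For every set of formulas $\Gamma\cup\{\varphi\}$ of the multi-modal language $\mathbf{MFm}$ over $\mathbf{B}$, we have $\Gamma\vdash_{\mathsf{mM}_{\mathbf{B}}}\varphi$ if and only if $\Gamma\Vdash_{\mathcal{P}_{\mathbf{B}}}\varphi$.
   Context: A finite MTL-chain is a finite, linearly ordered, bounded, integral, commutative residuated lattice $\mathbf{B}=(B,\wedge,\vee,\odot,\to,0,1)$. Language $\mathbf{MFm}$: built from a set $\mathcal V$ of propositional variables, a truth constant $\overline{b}$ for each $b\in B$, binary connectives $\wedge,\vee,\odot,\to$, and a unary modality $\Box_b$ for each $b\in B$. Abbreviations: $\varphi\leftrightarrow\psi:=(\varphi\to\psi)\odot(\psi\to\varphi)$ and $\Diamond_b\varphi:=\bigwedge_{a\in B}(\Box_b(\varphi\to\overline a)\to\overline a)$. Semantics: a $\mathbf B$-preference model is $\mathfrak M=(W,P,e)$ with $W$ a nonempty set, $P:W\times W\to B$ reflexive ($P(u,u)=1$) and $\wedge$-transitive ($P(u,v)\wedge P(v,w)\le P(u,w)$), and $e:W\times\mathcal V\to B$; $e$ extends to all formulas by $e(v,\overline b)=b$, propositional connectives computed by the operations of $\mathbf B$, and $e(v,\Box_b\varphi)=\bigwedge\{e(w,\varphi): w\in W,\ P(v,w)\ge b\}$. $\mathcal P_{\mathbf B}$ is the class of all such models, and $\Gamma\Vdash_{\mathcal P_{\mathbf B}}\varphi$ means: for every model in $\mathcal P_{\mathbf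 B}$ and every world $v$, if $e(v,\gamma)=1$ for all $\gamma\in\Gamma$ then $e(v,\varphi)=1$. Axiomatic system $\mathsf{mM}_{\mathbf B}$: (1) all instances (in $\mathbf{MFm}$) of the axioms and rules of a fixed sound and complete Hilbert-style axiomatization of the propositional consequence relation of $\mathbf B$ expanded with its constants $\overline b$ (propositional consequence: for all homomorphisms $h$ into $\mathbf B$ with $h(\overline b)=b$, $h[\Gamma]\subseteq\{1\}$ implies $h(\varphi)=1$), including modus ponens; (2) for each $b\in B$, with $\Box=\Box_b$ and $k$ the coatom of $\mathbf B$: $\Box\overline 1$; $(\Box\varphi\wedge\Box\psi)\to\Box(\varphi\wedge\psi)$; $\Box(\overline a\to\varphi)\leftrightarrow(\overline a\to\Box\varphi)$ for each $a\in B$; $\Box(\overline k\vee\varphi)\to(\overline k\vee\Box\varphi)$; $\Box(\varphi\to\psi)\to(\Box\varphi\to\Box\psi)$; the monotonicity rule (from $\varphi\to\psi$ derive $\Box\varphi\to\Box\psi$) and the necessitation rule (from $\varphi$ derive $\Box\varphi$); (3) nestedness: $\Box_a\varphi\to\Box_b\varphi$ for $a\le b$; (4) $\Box_a\varphi\to\varphi$ for each $a\in B$; (5) $\Box_{a\wedge b}\varphi\to\Box_a\Box_b\varphi$ for all $a,b\in B$; (6) $\varphi\to\Box_0\Diamond_0\varphi$. $\Gamma\vdash_{\mathsf{mM}_{\mathbf B}}\varphi$ means there is a finite derivation of $\varphi$ from axioms and members of $\Gamma$ using the propositional rules, where the modal rules (monotonicity, necessitation) are only applied to theorems (formulas derivable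 from the empty set). *)

theory Defs
  imports Main
begin

section \<open>Finite MTL-chains\<close>

text \<open>Integrality is the axiom that the unit of the monoid is the greatest element.\<close>

class finite_mtl_chain = finite + linorder + bounded_lattice +
  fixes odot :: "'a \<Rightarrow> 'a \<Rightarrow> 'a"  (infixl \<open>\<odot>\<close> 70)
    and residuum :: "'a \<Rightarrow> 'a \<Rightarrow> 'a"  (infixr \<open>\<leadsto>\<close> 65)
  assumes odot_assoc: "(a \<odot> b) \<odot> c = a \<odot> (b \<odot> c)"
    and odot_commute: "a \<odot> b = b \<odot> a"
    and odot_top: "a \<odot> top = a"
    and residuation: "a \<odot> b \<le> c \<longleftrightarrow> a \<le> b \<leadsto> c"

definition coatom :: "'b::finite_mtl_chain \<Rightarrow> bool" where
  "coatom k \<longleftrightarrow> k < top \<and> (\<forall>x. k < x \<longrightarrow> x = top)"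


section \<open>Propositional logic of a finite MTL-chain with truth constants\<close>

text \<open>Propositional axioms and rules are schemata. Their metavariables are indexed by
  natural numbers, independently of the set of variables of the modal language.\<close>

datatype 'b pfm =
    PVar nat
  | PConst 'b
  | PAnd "'b pfm" "'b pfm"
  | POr "'b pfm" "'b pfm"
  | PFus "'b pfm" "'b pfm"
  | PImp "'b pfm" "'b pfm"

primrec psubst :: "(nat \<Rightarrow> 'b pfm) \<Rightarrow> 'b pfm \<Rightarrow> 'b pfm" where
  "psubst \<sigma> (PVar x) = \<sigma> x"
| "psubst \<sigma> (PConst b) = PConst b"
| "psubst \<sigma> (PAnd p q) = PAnd (psubst \<sigma> p) (psubst \<sigma> q)"
| "psubst \<sigma> (POr p q) = POr (psubst \<sigma> p) (psubst \<sigma> q)"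
| "psubst \<sigma> (PFus p q) = PFus (psubst \<sigma> p) (psubst \<sigma> q)"
| "psubst \<sigma> (PImp p q) = PImp (psubst \<sigma> p) (psubst \<sigma> q)"

definition prop_hom :: "('b::finite_mtl_chain pfm \<Rightarrow> 'b) \<Rightarrow> bool" where
  "prop_hom h \<longleftrightarrow>
     (\<forall>b. h (PConst b) = b) \<and>
     (\<forall>p q. h (PAnd p q) = inf (h p) (h q)) \<and>
     (\<forall>p q. h (POr p q) = sup (h p) (h q)) \<and>
     (\<forall>p q. h (PFus p q) = h p \<odot> h q) \<and>
     (\<forall>p q. h (PImp p q) = h p \<leadsto> h q)"

definition prop_conseq :: "'b::finite_mtl_chain pfm set \<Rightarrow> 'b pfm \<Rightarrow> bool" where
  "prop_conseq \<Gamma> p \<longleftrightarrow> (\<forall>h. prop_hom h \<longrightarrow> h ` \<Gamma> \<subseteq> {top} \<longrightarrow> h p = top)"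

text \<open>A Hilbert-style system consists of a set of axiom schemata and a set of rule
  schemata (premises, conclusion).\<close>

inductive prop_deriv ::
  "'b pfm set \<Rightarrow> ('b pfm set \<times> 'b pfm) set \<Rightarrow> 'b pfm set \<Rightarrow> 'b pfm \<Rightarrow> bool"
  for Ax Ru \<Gamma> where
  hyp: "p \<in> \<Gamma> \<Longrightarrow> prop_deriv Ax Ru \<Gamma> p"
| ax: "p \<in> Ax \<Longrightarrow> prop_deriv Ax Ru \<Gamma> (psubst \<sigma> p)"
| rule: "(X, p) \<in> Ru \<Longrightarrow> (\<And>q. q \<in> X \<Longrightarrow> prop_deriv Ax Ru \<Gamma> (psubst \<sigma> q))
    \<Longrightarrow> prop_deriv Ax Ru \<Gamma> (psubst \<sigma> p)"

definition prop_axiomatization ::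
  "'b::finite_mtl_chain pfm set \<Rightarrow> ('b pfm set \<times> 'b pfm) set \<Rightarrow> bool" where
  "prop_axiomatization Ax Ru \<longleftrightarrow>
     (\<forall>(X, p) \<in> Ru. finite X) \<and>
     (\<exists>x y. x \<noteq> y \<and> ({PVar x, PImp (PVar x) (PVar y)}, PVar y) \<in> Ru) \<and>
     (\<forall>\<Gamma> p. prop_deriv Ax Ru \<Gamma> p \<longleftrightarrow> prop_conseq \<Gamma> p)"


section \<open>The multi-modal language\<close>

datatype ('b, 'v) fm =
    Var 'v
  | Const 'b
  | And "('b, 'v) fm" "('b, 'v) fm"  (infixr \<open>\<^bold>\<and>\<close> 75)
  | Or "('b, 'v) fm" "('b, 'v) fm"  (infixr \<open>\<^bold>\<or>\<close> 74)
  | Fus "('b, 'v) fm" "('b, 'v) fm"  (infixr \<open>\<^bold>\<odot>\<close> 76)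
  | Imp "('b, 'v) fm" "('b, 'v) fm"  (infixr \<open>\<^bold>\<rightarrow>\<close> 73)
  | Box 'b "('b, 'v) fm"

definition Iff :: "('b, 'v) fm \<Rightarrow> ('b, 'v) fm \<Rightarrow> ('b, 'v) fm"  (infix \<open>\<^bold>\<leftrightarrow>\<close> 72) where
  "\<phi> \<^bold>\<leftrightarrow> \<psi> = (\<phi> \<^bold>\<rightarrow> \<psi>) \<^bold>\<odot> (\<psi> \<^bold>\<rightarrow> \<phi>)"

fun conj_list :: "('b::finite_mtl_chain, 'v) fm list \<Rightarrow> ('b, 'v) fm" where
  "conj_list [] = Const top"
| "conj_list [\<phi>] = \<phi>"
| "conj_list (\<phi> # \<psi> # \<phi>s) = \<phi> \<^bold>\<and> conj_list (\<psi> # \<phi>s)"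

text \<open>The conjunction over all elements of the chain is taken in increasing order.\<close>

definition Dia :: "'b::finite_mtl_chain \<Rightarrow> ('b, 'v) fm \<Rightarrow> ('b, 'v) fm" where
  "Dia b \<phi> =
     conj_list (map (\<lambda>a. Box b (\<phi> \<^bold>\<rightarrow> Const a) \<^bold>\<rightarrow> Const a) (sorted_list_of_set UNIV))"

primrec inst :: "(nat \<Rightarrow> ('b, 'v) fm) \<Rightarrow> 'b pfm \<Rightarrow> ('b, 'v) fm" where
  "inst \<sigma> (PVar x) = \<sigma> x"
| "inst \<sigma> (PConst b) = Const b"
| "inst \<sigma> (PAnd p q) = inst \<sigma> p \<^bold>\<and> inst \<sigma> q"
| "inst \<sigma> (POr p q) = inst \<sigma> p \<^bold>\<or> inst \<sigma> q"
| "inst \<sigma> (PFus p q) = inst \<sigma> p \<^bold>\<odot> inst \<sigma> q"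
| "inst \<sigma> (PImp p q) = inst \<sigma> p \<^bold>\<rightarrow> inst \<sigma> q"


section \<open>Preference models\<close>

definition preference_model :: "'w set \<Rightarrow> ('w \<Rightarrow> 'w \<Rightarrow> 'b::finite_mtl_chain) \<Rightarrow> bool" where
  "preference_model W P \<longleftrightarrow>
     W \<noteq> {} \<and>
     (\<forall>u\<in>W. P u u = top) \<and>
     (\<forall>u\<in>W. \<forall>v\<in>W. \<forall>w\<in>W. inf (P u v) (P v w) \<le> P u w)"

text \<open>In the clause for the modality the set of values is finite because the chain is, and
  it is nonempty at every world of a preference model by reflexivity.\<close>

primrec eval :: "'w set \<Rightarrow> ('w \<Rightarrow> 'w \<Rightarrow> 'b) \<Rightarrow> ('w \<Rightarrow> 'v \<Rightarrow> 'b)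
    \<Rightarrow> ('b::finite_mtl_chain, 'v) fm \<Rightarrow> 'w \<Rightarrow> 'b" where
  "eval W P e (Var x) v = e v x"
| "eval W P e (Const b) v = b"
| "eval W P e (\<phi> \<^bold>\<and> \<psi>) v = inf (eval W P e \<phi> v) (eval W P e \<psi> v)"
| "eval W P e (\<phi> \<^bold>\<or> \<psi>) v = sup (eval W P e \<phi> v) (eval W P e \<psi> v)"
| "eval W P e (\<phi> \<^bold>\<odot> \<psi>) v = eval W P e \<phi> v \<odot> eval W P e \<psi> v"
| "eval W P e (\<phi> \<^bold>\<rightarrow> \<psi>) v = eval W P e \<phi> v \<leadsto> eval W P e \<psi> v"
| "eval W P e (Box b \<phi>) v = Inf_fin ((\<lambda>w. eval W P e \<phi> w) ` {w \<in> W. b \<le> P v w})"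

text \<open>Local consequence over all preference models whose worlds form a set of elements of
  the type given by the first argument.\<close>

definition pref_conseq ::
  "'w itself \<Rightarrow> ('b::finite_mtl_chain, 'v) fm set \<Rightarrow> ('b, 'v) fm \<Rightarrow> bool" where
  "pref_conseq T \<Gamma> \<phi> \<longleftrightarrow>
     (\<forall>(W :: 'w set) P e. preference_model W P \<longrightarrow>
        (\<forall>v\<in>W. (\<forall>\<gamma>\<in>\<Gamma>. eval W P e \<gamma> v = top) \<longrightarrow> eval W P e \<phi> v = top))"


section \<open>The axiomatic system\<close>

inductive_set modal_axioms :: "('b::finite_mtl_chain, 'v) fm set" where
  box_one: "Box b (Const top) \<in> modal_axioms"
| box_and: "(Box b \<phi> \<^bold>\<and> Box b \<psi>) \<^bold>\<rightarrow> Box b (\<phi> \<^bold>\<and> \<psi>) \<in> modal_axioms"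
| box_const: "Box b (Const a \<^bold>\<rightarrow> \<phi>) \<^bold>\<leftrightarrow> (Const a \<^bold>\<rightarrow> Box b \<phi>) \<in> modal_axioms"
| box_coatom: "coatom k \<Longrightarrow>
    Box b (Const k \<^bold>\<or> \<phi>) \<^bold>\<rightarrow> (Const k \<^bold>\<or> Box b \<phi>) \<in> modal_axioms"
| box_K: "Box b (\<phi> \<^bold>\<rightarrow> \<psi>) \<^bold>\<rightarrow> (Box b \<phi> \<^bold>\<rightarrow> Box b \<psi>) \<in> modal_axioms"
| box_nested: "a \<le> b \<Longrightarrow> Box a \<phi> \<^bold>\<rightarrow> Box b \<phi> \<in> modal_axioms"
| box_T: "Box a \<phi> \<^bold>\<rightarrow> \<phi> \<in> modal_axioms"
| box_4: "Box (inf a b) \<phi> \<^bold>\<rightarrow> Box a (Box b \<phi>) \<in> modal_axioms"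
| box_B: "\<phi> \<^bold>\<rightarrow> Box bot (Dia bot \<phi>) \<in> modal_axioms"

inductive mM_deriv ::
  "'b::finite_mtl_chain pfm set \<Rightarrow> ('b pfm set \<times> 'b pfm) set
    \<Rightarrow> ('b, 'v) fm set \<Rightarrow> ('b, 'v) fm \<Rightarrow> bool"
  for Ax Ru where
  hyp: "\<phi> \<in> \<Gamma> \<Longrightarrow> mM_deriv Ax Ru \<Gamma> \<phi>"
| prop_ax: "p \<in> Ax \<Longrightarrow> mM_deriv Ax Ru \<Gamma> (inst \<sigma> p)"
| prop_rule: "(X, p) \<in> Ru \<Longrightarrow> (\<And>q. q \<in> X \<Longrightarrow> mM_deriv Ax Ru \<Gamma> (inst \<sigma> q))
    \<Longrightarrow> mM_deriv Ax Ru \<Gamma> (inst \<sigma> p)"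
| modal_ax: "\<phi> \<in> modal_axioms \<Longrightarrow> mM_deriv Ax Ru \<Gamma> \<phi>"
| mono: "mM_deriv Ax Ru {} (\<phi> \<^bold>\<rightarrow> \<psi>) \<Longrightarrow> mM_deriv Ax Ru \<Gamma> (Box b \<phi> \<^bold>\<rightarrow> Box b \<psi>)"
| nec: "mM_deriv Ax Ru {} \<phi> \<Longrightarrow> mM_deriv Ax Ru \<Gamma> (Box b \<phi>)"

end

theory Submission
  imports Defs "HOL-Analysis.Function_Topology"
begin

text \<open>Completeness is shown by a canonical model. Its worlds are the propositional valuations
  \<open>h\<close> of modal formulas, with boxed formulas as atoms, that map all theorems to \<open>top\<close>; by
  compactness of finite-valued propositional logic, a formula that is not derivable fails in such
  a world \<open>h\<^sub>0\<close>. Let \<open>acc b h g\<close> mean \<open>h (Box b \<chi>) \<le> g \<chi>\<close> for all \<open>\<chi>\<close>. The set of \<open>\<chi>\<close> with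
  \<open>h (Box b \<chi>) = top\<close> is closed under propositional consequence, and applied to
  \<open>Const c \<^bold>\<rightarrow> \<psi>\<close>, where \<open>c\<close> is the infimum of \<open>g \<psi>\<close> over the successors \<open>g\<close> of \<open>h\<close>, this
  gives the truth lemma for \<open>Box b \<psi>\<close>. The relations \<open>acc b\<close> decrease in \<open>b\<close>, so a single
  graded preference encodes them all, provided \<open>acc bot\<close> is total. It is an equivalence relation
  by the axioms T, 4 and B, so it suffices to restrict to the class of \<open>h\<^sub>0\<close>.\<close>

subsection \<open>Finite MTL-chains\<close>

lemma residuum_eq_top_iff: "a \<leadsto> b = top \<longleftrightarrow> a \<le> (b :: 'b::finite_mtl_chain)"
  by (metis odot_commute odot_top residuation top_le top_greatest)

lemma odot_mono: "a \<le> a' \<Longrightarrow> b \<le> b' \<Longrightarrow> a \<odot> b \<le> a' \<odot> (b' :: 'b::finite_mtl_chain)"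
  by (metis odot_commute order.refl order.trans residuation)

lemma odot_residuum_le: "(a :: 'b::finite_mtl_chain) \<odot> (a \<leadsto> b) \<le> b"
  by (subst odot_commute) (simp add: residuation)

lemma odot_le_left: "a \<odot> b \<le> (a :: 'b::finite_mtl_chain)"
  by (metis odot_mono odot_top order.refl top_greatest)

lemma odot_eq_top_iff: "a \<odot> b = top \<longleftrightarrow> a = top \<and> b = (top :: 'b::finite_mtl_chain)"
  by (metis odot_commute odot_le_left odot_top top_le)

text \<open>The one-element chain belongs to the class and has no coatom; a value other than
  \<open>top\<close> excludes it.\<close>

lemma ex_coatom:
  assumes "(a :: 'b::finite_mtl_chain) \<noteq> top"
  shows "\<exists>k :: 'b. coatom k"
proof
  have ne: "{x :: 'b. x < top} \<noteq> {}"
    using assms top.not_eq_extremum by blast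
  let ?k = "Max {x :: 'b. x < top}"
  have "?k < top"
    using Max_in[OF _ ne] by simp
  moreover have "x = top" if "?k < x" for x
    using that Max_ge[of "{x :: 'b. x < top}" x] top.not_eq_extremum by fastforce
  ultimately show "coatom ?k"
    by (simp add: coatom_def)
qed

lemma sup_coatom_eq_top_iff:
  assumes "coatom (k :: 'b::finite_mtl_chain)"
  shows "sup k x = top \<longleftrightarrow> x = top"
  using assms by (auto simp: coatom_def sup_max max_def)

text \<open>Every value except \<open>top\<close> lies below the coatom, so joining with
  \<open>k\<close> forgets all but whether a value is \<open>top\<close>. An implication formula can
  thus express preservation of truth.\<close>

lemma le_sup_coatom_iff:
  assumes "coatom (k :: 'b::finite_mtl_chain)"
  shows "x \<le> sup k y \<longleftrightarrow> (x = top \<longrightarrow> y = top)"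
proof (cases "x = top")
  case True
  then show ?thesis
    using sup_coatom_eq_top_iff[OF assms, of y] by (simp add: top_unique)
next
  case False
  then have "x \<le> k"
    using assms by (metis coatom_def not_le)
  then show ?thesis
    using False by (simp add: le_supI1)
qed

subsection \<open>Propositional entailment between modal formulas\<close>

text \<open>The propositional extension of a valuation that treats variables and boxed formulas as
  atoms; the values of \<open>v\<close> at all other formulas are ignored.\<close>

primrec ext :: "(('b::finite_mtl_chain, 'v) fm \<Rightarrow> 'b) \<Rightarrow> ('b, 'v) fm \<Rightarrow> 'b" where
  "ext v (Var x) = v (Var x)"
| "ext v (Const b) = b"
| "ext v (\<phi> \<^bold>\<and> \<psi>) = inf (ext v \<phi>) (ext v \<psi>)"
| "ext v (\<phi> \<^bold>\<or> \<psi>) = sup (ext v \<phi>) (ext v \<psi>)"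
| "ext v (\<phi> \<^bold>\<odot> \<psi>) = ext v \<phi> \<odot> ext v \<psi>"
| "ext v (\<phi> \<^bold>\<rightarrow> \<psi>) = ext v \<phi> \<leadsto> ext v \<psi>"
| "ext v (Box b \<phi>) = v (Box b \<phi>)"

lemma ext_Iff: "ext v (\<phi> \<^bold>\<leftrightarrow> \<psi>) = top \<longleftrightarrow> ext v \<phi> = ext v \<psi>"
  by (auto simp: Iff_def odot_eq_top_iff residuum_eq_top_iff)

lemma le_ext_conj_list: "x \<le> ext v (conj_list \<phi>s) \<longleftrightarrow> (\<forall>\<phi>\<in>set \<phi>s. x \<le> ext v \<phi>)"
  by (induction \<phi>s rule: conj_list.induct) auto

lemma le_ext_Dia:
  "x \<le> ext v (Dia b \<phi>) \<longleftrightarrow> (\<forall>a. x \<le> v (Box b (\<phi> \<^bold>\<rightarrow> Const a)) \<leadsto> a)"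
  by (simp add: Dia_def le_ext_conj_list)

lemma prop_hom_ext_inst: "prop_hom (\<lambda>p. ext v (inst \<sigma> p))"
  by (simp add: prop_hom_def)

definition entails :: "('b::finite_mtl_chain, 'v) fm set \<Rightarrow> ('b, 'v) fm \<Rightarrow> bool" where
  "entails \<Delta> \<phi> \<longleftrightarrow> (\<forall>v. (\<forall>\<delta>\<in>\<Delta>. ext v \<delta> = top) \<longrightarrow> ext v \<phi> = top)"

section \<open>Compactness of propositional entailment\<close>

primrec atoms :: "('b, 'v) fm \<Rightarrow> ('b, 'v) fm set" where
  "atoms (Var x) = {Var x}"
| "atoms (Const b) = {}"
| "atoms (\<phi> \<^bold>\<and> \<psi>) = atoms \<phi> \<union> atoms \<psi>"
| "atoms (\<phi> \<^bold>\<or> \<psi>) = atoms \<phi> \<union> atoms \<psi>"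
| "atoms (\<phi> \<^bold>\<odot> \<psi>) = atoms \<phi> \<union> atoms \<psi>"
| "atoms (\<phi> \<^bold>\<rightarrow> \<psi>) = atoms \<phi> \<union> atoms \<psi>"
| "atoms (Box b \<phi>) = {Box b \<phi>}"

lemma finite_atoms: "finite (atoms \<phi>)"
  by (induction \<phi>) auto

lemma ext_cong: "(\<And>\<alpha>. \<alpha> \<in> atoms \<phi> \<Longrightarrow> u \<alpha> = v \<alpha>) \<Longrightarrow> ext u \<phi> = ext v \<phi>"
  by (induction \<phi>) auto

text \<open>This is compactness of a power of a finite discrete space.\<close>

lemma finitely_determined_compactness:
  fixes A :: "'i \<Rightarrow> ('a \<Rightarrow> 'b::finite) set"
  assumes finite_support: "\<And>i. i \<in> I \<Longrightarrow>
      \<exists>D. finite D \<and> (\<forall>u v. (\<forall>x\<in>D. u x = v x) \<longrightarrow> u \<in> A i \<longrightarrow> v \<in> A i)"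
    and fip: "\<And>J. finite J \<Longrightarrow> J \<subseteq> I \<Longrightarrow> (\<Inter>i\<in>J. A i) \<noteq> {}"
  shows "(\<Inter>i\<in>I. A i) \<noteq> {}"
proof -
  let ?X = "product_topology (\<lambda>_ :: 'a. discrete_topology (UNIV :: 'b set)) UNIV"
  have compact: "compact_space ?X"
    by (simp add: compact_space_product_topology compact_space_discrete_topology)
  have closed: "closedin ?X (A i)" if i: "i \<in> I" for i
  proof -
    obtain D where D: "finite D" "\<And>u v. (\<forall>x\<in>D. u x = v x) \<Longrightarrow> u \<in> A i \<Longrightarrow> v \<in> A i"
      using finite_support[OF i] by blast
    have "openin ?X (- A i)"
      unfolding openin_product_topology_alt
    proof
      fix u assume u: "u \<in> - A i"
      \<comment> \<open>Fixing \<open>u\<close> on the finite set \<open>D\<close> gives a basic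
        open neighbourhood disjoint from \<open>A i\<close>.\<close>
      let ?U = "\<lambda>x. if x \<in> D then {u x} else UNIV"
      have "finite {x. ?U x \<noteq> UNIV}"
        by (rule finite_subset[OF _ D(1)]) auto
      moreover have "Pi\<^sub>E UNIV ?U \<subseteq> - A i"
      proof
        fix v assume v: "v \<in> Pi\<^sub>E UNIV ?U"
        have "v x = u x" if "x \<in> D" for x
          using PiE_mem[OF v, of x] that by simp
        then show "v \<in> - A i"
          using u D(2)[of v u] by blast
      qed
      ultimately show "\<exists>U. finite {x \<in> UNIV. U x \<noteq> topspace (discrete_topology (UNIV :: 'b set))} \<and>
          (\<forall>x\<in>UNIV. openin (discrete_topology UNIV) (U x)) \<and> u \<in> Pi\<^sub>E UNIV U \<and> Pi\<^sub>E UNIV U \<subseteq> - A i"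
        by (intro exI[of _ ?U]) auto
    qed
    then show ?thesis
      by (simp add: closedin_def Compl_eq_Diff_UNIV)
  qed
  have "\<Inter>\<F> \<noteq> {}" if "finite \<F>" "\<F> \<subseteq> A ` I" for \<F>
    using finite_subset_image[OF that] fip by metis
  then show ?thesis
    using compact[unfolded compact_space_fip, rule_format, of "A ` I"] closed by blast
qed

lemma entails_compact:
  assumes "entails \<Delta> \<phi>"
  shows "\<exists>\<Delta>\<^sub>0\<subseteq>\<Delta>. finite \<Delta>\<^sub>0 \<and> entails \<Delta>\<^sub>0 \<phi>"
proof (rule ccontr)
  assume "\<not> ?thesis"
  then have not_entails: "\<And>\<Delta>\<^sub>0. finite \<Delta>\<^sub>0 \<Longrightarrow> \<Delta>\<^sub>0 \<subseteq> \<Delta> \<Longrightarrow> \<not> entails \<Delta>\<^sub>0 \<phi>"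
    by blast
  \<comment> \<open>Failure of \<phi> is built into each set, so a common point refutes the
    entailment.\<close>
  define A where "A \<delta> = {v. ext v \<delta> = top \<and> ext v \<phi> \<noteq> top}" for \<delta>
  have "(\<Inter>\<delta>\<in>\<Delta>. A \<delta>) \<noteq> {}"
  proof (rule finitely_determined_compactness)
    fix \<delta>
    have "u \<in> A \<delta> \<longrightarrow> v \<in> A \<delta>" if "\<forall>\<alpha>\<in>atoms \<delta> \<union> atoms \<phi>. u \<alpha> = v \<alpha>" for u v
      using that ext_cong[of \<delta> u v] ext_cong[of \<phi> u v] by (simp add: A_def)
    then show "\<exists>D. finite D \<and> (\<forall>u v. (\<forall>\<alpha>\<in>D. u \<alpha> = v \<alpha>) \<longrightarrow> u \<in> A \<delta> \<longrightarrow> v \<in> A \<delta>)"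
      by (intro exI[of _ "atoms \<delta> \<union> atoms \<phi>"]) (simp add: finite_atoms)
  next
    fix \<Delta>\<^sub>0 assume "finite \<Delta>\<^sub>0" "\<Delta>\<^sub>0 \<subseteq> \<Delta>"
    then show "(\<Inter>\<delta>\<in>\<Delta>\<^sub>0. A \<delta>) \<noteq> {}"
      using not_entails[of \<Delta>\<^sub>0] by (auto simp: entails_def A_def)
  qed
  \<comment> \<open>Over an empty index set the intersection is \<open>UNIV\<close> and refutes
    nothing; but an empty \<Delta> would itself be a finite subset.\<close>
  moreover have "\<Delta> \<noteq> {}"
    using assms not_entails[of "{}"] by auto
  ultimately show False
    using assms by (auto simp: entails_def A_def)
qed

subsection \<open>Propositional reasoning in the axiomatic system\<close>

lemma mM_deriv_mono:
  assumes "mM_deriv Ax Ru \<Gamma> \<phi>" "\<Gamma> \<subseteq> \<Gamma>'"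
  shows "mM_deriv Ax Ru \<Gamma>' \<phi>"
  using assms by (induction arbitrary: \<Gamma>') (blast intro: mM_deriv.intros)+

lemma inst_psubst: "inst \<sigma> (psubst \<tau> p) = inst (\<lambda>n. inst \<sigma> (\<tau> n)) p"
  by (induction p) auto

lemma psubst_PVar: "psubst PVar p = p"
  by (induction p) auto

lemma mM_deriv_inst:
  assumes "prop_deriv Ax Ru Y p" "\<And>q. q \<in> Y \<Longrightarrow> mM_deriv Ax Ru \<Gamma> (inst \<sigma> q)"
  shows "mM_deriv Ax Ru \<Gamma> (inst \<sigma> p)"
  using assms
proof induction
  case (ax p \<tau>)
  then show ?case
    by (simp add: inst_psubst mM_deriv.prop_ax)
next
  case (rule X p \<tau>)
  then show ?case
    unfolding inst_psubst by (blast intro: mM_deriv.prop_rule)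
qed

text \<open>Schemata have only countably many variables, while the modal language may have
  uncountably many atoms. A numbering \<open>f\<close> is therefore used that need only be injective
  on the finitely many atoms at hand.\<close>

primrec enc :: "(('b, 'v) fm \<Rightarrow> nat) \<Rightarrow> ('b, 'v) fm \<Rightarrow> 'b pfm" where
  "enc f (Var x) = PVar (f (Var x))"
| "enc f (Const b) = PConst b"
| "enc f (\<phi> \<^bold>\<and> \<psi>) = PAnd (enc f \<phi>) (enc f \<psi>)"
| "enc f (\<phi> \<^bold>\<or> \<psi>) = POr (enc f \<phi>) (enc f \<psi>)"
| "enc f (\<phi> \<^bold>\<odot> \<psi>) = PFus (enc f \<phi>) (enc f \<psi>)"
| "enc f (\<phi> \<^bold>\<rightarrow> \<psi>) = PImp (enc f \<phi>) (enc f \<psi>)"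
| "enc f (Box b \<phi>) = PVar (f (Box b \<phi>))"

lemma inst_enc: "(\<And>\<alpha>. \<alpha> \<in> atoms \<phi> \<Longrightarrow> \<sigma> (f \<alpha>) = \<alpha>) \<Longrightarrow> inst \<sigma> (enc f \<phi>) = \<phi>"
  by (induction \<phi>) auto

lemma prop_hom_enc: "prop_hom h \<Longrightarrow> h (enc f \<phi>) = ext (\<lambda>\<alpha>. h (enc f \<alpha>)) \<phi>"
  by (induction \<phi>) (simp_all add: prop_hom_def)

text \<open>Compactness leaves finitely many premises; encoded as schemata, they yield a
  propositional derivation by the assumed completeness, and \<open>inst\<close> decodes it.\<close>

lemma mM_deriv_entails:
  assumes ax: "prop_axiomatization Ax Ru"
    and "entails \<Delta> \<phi>" and deriv: "\<And>\<delta>. \<delta> \<in> \<Delta> \<Longrightarrow> mM_deriv Ax Ru \<Gamma> \<delta>"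
  shows "mM_deriv Ax Ru \<Gamma> \<phi>"
proof -
  obtain \<Delta>\<^sub>0 where \<Delta>\<^sub>0: "\<Delta>\<^sub>0 \<subseteq> \<Delta>" "finite \<Delta>\<^sub>0" "entails \<Delta>\<^sub>0 \<phi>"
    using entails_compact assms(2) by blast
  define S where "S = (\<Union>\<psi>\<in>insert \<phi> \<Delta>\<^sub>0. atoms \<psi>)"
  have "finite S"
    using \<Delta>\<^sub>0(2) by (simp add: S_def finite_atoms)
  then obtain f :: "_ \<Rightarrow> nat" where f: "inj_on f S"
    using finite_imp_inj_to_nat_seg[of S] by blast
  define \<sigma> where "\<sigma> = inv_into S f"
  have inst: "inst \<sigma> (enc f \<psi>) = \<psi>" if "\<psi> \<in> insert \<phi> \<Delta>\<^sub>0" for \<psi>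
    using that f by (intro inst_enc) (auto simp: \<sigma>_def S_def intro!: inv_into_f_f)
  have "prop_conseq (enc f ` \<Delta>\<^sub>0) (enc f \<phi>)"
    unfolding prop_conseq_def
  proof (intro allI impI)
    fix h :: "'a pfm \<Rightarrow> 'a"
    assume h: "prop_hom h" "h ` enc f ` \<Delta>\<^sub>0 \<subseteq> {top}"
    then have "\<forall>\<delta>\<in>\<Delta>\<^sub>0. ext (\<lambda>\<alpha>. h (enc f \<alpha>)) \<delta> = top"
      by (auto simp flip: prop_hom_enc[OF h(1)])
    then have "ext (\<lambda>\<alpha>. h (enc f \<alpha>)) \<phi> = top"
      using \<Delta>\<^sub>0(3) by (simp add: entails_def)
    then show "h (enc f \<phi>) = top"
      by (simp flip: prop_hom_enc[OF h(1)])
  qed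
  then have "prop_deriv Ax Ru (enc f ` \<Delta>\<^sub>0) (enc f \<phi>)"
    using ax by (simp add: prop_axiomatization_def)
  then have "mM_deriv Ax Ru \<Gamma> (inst \<sigma> (enc f \<phi>))"
    by (rule mM_deriv_inst) (use \<Delta>\<^sub>0(1) deriv inst in auto)
  then show ?thesis
    using inst by simp
qed

subsection \<open>Soundness\<close>

text \<open>Boxed formulas are atoms for \<open>ext\<close>, so their semantic values enter
  unchanged. Propositional facts thereby apply at each world.\<close>

lemma eval_eq_ext: "eval W P e \<phi> v = ext (\<lambda>\<psi>. eval W P e \<psi> v) \<phi>"
  by (induction \<phi>) simp_all

text \<open>Reflexivity makes the set of successors nonempty, so \<open>Inf_fin\<close> is a genuine
  infimum.\<close>

lemma le_eval_Box_iff: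
  assumes "preference_model W P" "v \<in> W"
  shows "x \<le> eval W P e (Box b \<phi>) v \<longleftrightarrow> (\<forall>w\<in>W. b \<le> P v w \<longrightarrow> x \<le> eval W P e \<phi> w)"
proof -
  have "v \<in> {w \<in> W. b \<le> P v w}"
    using assms by (simp add: preference_model_def)
  then have "eval W P e \<phi> ` {w \<in> W. b \<le> P v w} \<noteq> {}"
    by blast
  then show ?thesis
    by (subst eval.simps, subst Inf_fin.bounded_iff) auto
qed

lemma eval_Box_le:
  assumes "preference_model W P" "v \<in> W" "w \<in> W" "b \<le> P v w"
  shows "eval W P e (Box b \<phi>) v \<le> eval W P e \<phi> w"
  using le_eval_Box_iff[OF assms(1,2)] assms(3,4) by blast

lemma modal_axioms_sound:
  assumes "\<phi> \<in> modal_axioms" and M: "preference_model W P" and v: "v \<in> W"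
  shows "eval W P e \<phi> v = top"
  using assms(1)
proof cases
  case (box_one b)
  then show ?thesis
    using le_eval_Box_iff[OF M v, of top e b] by (simp add: top_unique del: eval.simps(7))
next
  case (box_and b \<phi> \<psi>)
  have "inf (eval W P e (Box b \<phi>) v) (eval W P e (Box b \<psi>) v) \<le> eval W P e (Box b (\<phi> \<^bold>\<and> \<psi>)) v"
    unfolding le_eval_Box_iff[OF M v]
    by (auto simp del: eval.simps(7) intro: le_infI1 le_infI2 eval_Box_le[OF M v])
  then show ?thesis
    by (simp add: box_and residuum_eq_top_iff)
next
  case (box_const b a \<phi>)
  \<comment> \<open>Both sides have the same lower bounds, by residuation at each successor.\<close>
  have "x \<le> eval W P e (Box b (Const a \<^bold>\<rightarrow> \<phi>)) v \<longleftrightarrow> x \<le> a \<leadsto> eval W P e (Box b \<phi>) v" for x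
    unfolding residuation[symmetric] le_eval_Box_iff[OF M v] by (simp add: residuation)
  then have "eval W P e (Box b (Const a \<^bold>\<rightarrow> \<phi>)) v = eval W P e (Const a \<^bold>\<rightarrow> Box b \<phi>) v"
    by (simp del: eval.simps(7) add: order_eq_iff)
  then show ?thesis
    using box_const eval_eq_ext ext_Iff by metis
next
  case (box_coatom k b \<phi>)
  have "top \<le> eval W P e (Box b (Const k \<^bold>\<or> \<phi>)) v \<Longrightarrow> top \<le> eval W P e (Box b \<phi>) v"
    unfolding le_eval_Box_iff[OF M v] by (simp add: le_sup_coatom_iff[OF box_coatom(2)] top_unique)
  then have "eval W P e (Box b (Const k \<^bold>\<or> \<phi>)) v \<le> sup k (eval W P e (Box b \<phi>) v)"
    by (simp add: le_sup_coatom_iff[OF box_coatom(2)] top_unique del: eval.simps(7))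
  then show ?thesis
    by (simp add: box_coatom residuum_eq_top_iff)
next
  case (box_K b \<phi> \<psi>)
  let ?x = "eval W P e (Box b (\<phi> \<^bold>\<rightarrow> \<psi>)) v" and ?y = "eval W P e (Box b \<phi>) v"
  have "?x \<odot> ?y \<le> eval W P e (Box b \<psi>) v"
    unfolding le_eval_Box_iff[OF M v]
  proof (intro ballI impI)
    fix w assume w: "w \<in> W" "b \<le> P v w"
    then have "?x \<le> eval W P e \<phi> w \<leadsto> eval W P e \<psi> w" "?y \<le> eval W P e \<phi> w"
      using eval_Box_le[OF M v w, of e] by (metis eval.simps(6))+
    then have "?x \<odot> ?y \<le> (eval W P e \<phi> w \<leadsto> eval W P e \<psi> w) \<odot> eval W P e \<phi> w"
      by (rule odot_mono)
    also have "\<dots> \<le> eval W P e \<psi> w"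
      by (simp add: residuation)
    finally show "?x \<odot> ?y \<le> eval W P e \<psi> w" .
  qed
  then show ?thesis
    by (simp add: box_K residuum_eq_top_iff residuation)
next
  case (box_nested a b \<phi>)
  have "eval W P e (Box a \<phi>) v \<le> eval W P e (Box b \<phi>) v"
    unfolding le_eval_Box_iff[OF M v, of _ _ b]
    using eval_Box_le[OF M v] box_nested(2) by (blast intro: order.trans)
  then show ?thesis
    by (simp add: box_nested residuum_eq_top_iff)
next
  case (box_T a \<phi>)
  have "a \<le> P v v"
    using M v by (simp add: preference_model_def)
  then have "eval W P e (Box a \<phi>) v \<le> eval W P e \<phi> v"
    by (rule eval_Box_le[OF M v v])
  then show ?thesis
    by (simp add: box_T residuum_eq_top_iff)
next
  case (box_4 a b \<phi>)
  have "eval W P e (Box (inf a b) \<phi>) v \<le> eval W P e (Box a (Box b \<phi>)) v"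
    unfolding le_eval_Box_iff[OF M v, of _ _ a]
  proof (intro ballI impI)
    fix w assume w: "w \<in> W" "a \<le> P v w"
    have "inf a b \<le> P v u" if "u \<in> W" "b \<le> P w u" for u
      using M v w that unfolding preference_model_def by (meson inf_mono order.trans)
    then show "eval W P e (Box (inf a b) \<phi>) v \<le> eval W P e (Box b \<phi>) w"
      unfolding le_eval_Box_iff[OF M w(1)]
      using eval_Box_le[OF M v] by blast
  qed
  then show ?thesis
    by (simp add: box_4 residuum_eq_top_iff)
next
  case (box_B \<phi>)
  have "eval W P e \<phi> v \<le> eval W P e (Box bot (Dia bot \<phi>)) v"
    unfolding le_eval_Box_iff[OF M v]
  proof (intro ballI impI)
    fix w assume w: "w \<in> W"
    have "eval W P e \<phi> v \<odot> eval W P e (Box bot (\<phi> \<^bold>\<rightarrow> Const a)) w \<le> a" for a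
    proof -
      \<comment> \<open>At grade \<open>bot\<close> every world is a successor of every other, so
        \<open>w\<close> sees \<open>v\<close>.\<close>
      have "eval W P e (Box bot (\<phi> \<^bold>\<rightarrow> Const a)) w \<le> eval W P e (\<phi> \<^bold>\<rightarrow> Const a) v"
        by (rule eval_Box_le[OF M w v]) simp
      then have "eval W P e \<phi> v \<odot> eval W P e (Box bot (\<phi> \<^bold>\<rightarrow> Const a)) w
          \<le> eval W P e \<phi> v \<odot> (eval W P e \<phi> v \<leadsto> a)"
        by (intro odot_mono) (simp_all del: eval.simps(7))
      also have "\<dots> \<le> a"
        by (rule odot_residuum_le)
      finally show ?thesis .
    qed
    then show "eval W P e \<phi> v \<le> eval W P e (Dia bot \<phi>) w"
      unfolding eval_eq_ext[of W P e "Dia bot \<phi>"] le_ext_Dia residuation[symmetric] by blast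
  qed
  then show ?thesis
    by (simp add: box_B residuum_eq_top_iff)
qed

lemma mM_deriv_sound:
  assumes "prop_axiomatization Ax Ru" "mM_deriv Ax Ru \<Gamma> \<phi>"
    and M: "preference_model W P" and "v \<in> W" "\<forall>\<gamma>\<in>\<Gamma>. eval W P e \<gamma> v = top"
  shows "eval W P e \<phi> v = top"
  using assms(2,4,5)
proof (induction arbitrary: v)
  case (prop_ax p \<Gamma> \<sigma>)
  have "prop_deriv Ax Ru {} p"
    using prop_deriv.ax[OF prop_ax(1), of _ _ PVar] by (simp add: psubst_PVar)
  then have "prop_conseq {} p"
    using assms(1) by (simp add: prop_axiomatization_def)
  then show ?case
    by (subst eval_eq_ext) (use prop_hom_ext_inst in \<open>force simp: prop_conseq_def\<close>)
next
  case (prop_rule X p \<Gamma> \<sigma>)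
  \<comment> \<open>With its premises as hypotheses and the identity substitution, the rule is
    itself a derivation, so propositional soundness covers it.\<close>
  have "prop_deriv Ax Ru X p"
    using prop_deriv.rule[OF prop_rule(1), of _ _ PVar] by (simp add: psubst_PVar prop_deriv.hyp)
  then have "prop_conseq X p"
    using assms(1) by (simp add: prop_axiomatization_def)
  moreover have "\<forall>q\<in>X. ext (\<lambda>\<psi>. eval W P e \<psi> v) (inst \<sigma> q) = top"
    using prop_rule by (simp flip: eval_eq_ext)
  ultimately have "ext (\<lambda>\<psi>. eval W P e \<psi> v) (inst \<sigma> p) = top"
    using prop_hom_ext_inst[of "\<lambda>\<psi>. eval W P e \<psi> v" \<sigma>] by (auto simp: prop_conseq_def)
  then show ?case
    by (simp flip: eval_eq_ext)
next
  case (modal_ax \<phi> \<Gamma>)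
  then show ?case
    using modal_axioms_sound[OF _ M] by blast
next
  case (mono \<phi> \<psi> \<Gamma> b)
  \<comment> \<open>The premise is derived without hypotheses, so the induction hypothesis holds at
    every world, not only at \<open>v\<close>.\<close>
  have "eval W P e \<phi> w \<le> eval W P e \<psi> w" if "w \<in> W" for w
    using mono.IH[OF that] by (simp add: residuum_eq_top_iff)
  then have "eval W P e (Box b \<phi>) v \<le> eval W P e (Box b \<psi>) v"
    unfolding le_eval_Box_iff[OF M \<open>v \<in> W\<close>, of _ e b \<psi>]
    using eval_Box_le[OF M \<open>v \<in> W\<close>] by (blast intro: order.trans)
  then show ?case
    by (simp add: residuum_eq_top_iff)
next
  case (nec \<phi> \<Gamma> b)
  then show ?case
    using le_eval_Box_iff[OF M \<open>v \<in> W\<close>, of top e b \<phi>] by (simp add: top_unique del: eval.simps(7))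
qed auto

subsection \<open>The canonical model\<close>

definition world :: "'b::finite_mtl_chain pfm set \<Rightarrow> ('b pfm set \<times> 'b pfm) set
    \<Rightarrow> (('b, 'v) fm \<Rightarrow> 'b) \<Rightarrow> bool" where
  "world Ax Ru h \<longleftrightarrow> (\<exists>v. h = ext v) \<and> (\<forall>\<theta>. mM_deriv Ax Ru {} \<theta> \<longrightarrow> h \<theta> = top)"

definition acc :: "'b::finite_mtl_chain \<Rightarrow> (('b, 'v) fm \<Rightarrow> 'b) \<Rightarrow> (('b, 'v) fm \<Rightarrow> 'b) \<Rightarrow> bool" where
  "acc b h g \<longleftrightarrow> (\<forall>\<chi>. h (Box b \<chi>) \<le> g \<chi>)"

text \<open>Since accessibility is antitone in \<open>b\<close>, \<open>b \<le> canon_pref h g\<close> means \<open>acc b h g\<close>; this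
  needs \<open>acc bot h g\<close>, for otherwise the maximum is taken over the empty set.\<close>

definition canon_pref :: "(('b::finite_mtl_chain, 'v) fm \<Rightarrow> 'b) \<Rightarrow> (('b, 'v) fm \<Rightarrow> 'b) \<Rightarrow> 'b" where
  "canon_pref h g = Max {b. acc b h g}"

text \<open>An extended valuation satisfying all theorems is a world, so the assumption is an
  entailment from \<Gamma> together with the theorems.\<close>

lemma all_worlds_imp_mM_deriv:
  assumes "prop_axiomatization Ax Ru"
    and "\<And>h. world Ax Ru h \<Longrightarrow> \<forall>\<gamma>\<in>\<Gamma>. h \<gamma> = top \<Longrightarrow> h \<phi> = top"
  shows "mM_deriv Ax Ru \<Gamma> \<phi>"
proof (rule mM_deriv_entails[OF assms(1)])
  show "entails (\<Gamma> \<union> {\<theta>. mM_deriv Ax Ru {} \<theta>}) \<phi>"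
    using assms(2) by (auto simp: entails_def world_def)
qed (auto intro: mM_deriv.hyp mM_deriv_mono)

context
  fixes Ax :: "'b::finite_mtl_chain pfm set" and Ru :: "('b pfm set \<times> 'b pfm) set"
  assumes ax: "prop_axiomatization Ax Ru"
begin

lemma world_simps:
  assumes "world Ax Ru h"
  shows "h (Const b) = b"
    and "h (\<phi> \<^bold>\<and> \<psi>) = inf (h \<phi>) (h \<psi>)"
    and "h (\<phi> \<^bold>\<or> \<psi>) = sup (h \<phi>) (h \<psi>)"
    and "h (\<phi> \<^bold>\<odot> \<psi>) = h \<phi> \<odot> h \<psi>"
    and "h (\<phi> \<^bold>\<rightarrow> \<psi>) = h \<phi> \<leadsto> h \<psi>"
    and "h (\<phi> \<^bold>\<leftrightarrow> \<psi>) = top \<longleftrightarrow> h \<phi> = h \<psi>"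
    and "x \<le> h (Dia b \<phi>) \<longleftrightarrow> (\<forall>a. x \<le> h (Box b (\<phi> \<^bold>\<rightarrow> Const a)) \<leadsto> a)"
  using assms by (auto simp: world_def ext_Iff le_ext_Dia)

lemma world_theorem: "world Ax Ru h \<Longrightarrow> mM_deriv Ax Ru {} \<theta> \<Longrightarrow> h \<theta> = top"
  by (simp add: world_def)

lemma world_modal_axiom: "world Ax Ru h \<Longrightarrow> \<phi> \<in> modal_axioms \<Longrightarrow> h \<phi> = top"
  by (blast intro: world_theorem mM_deriv.modal_ax)

lemma world_imp_axiom: "world Ax Ru h \<Longrightarrow> \<phi> \<^bold>\<rightarrow> \<psi> \<in> modal_axioms \<Longrightarrow> h \<phi> \<le> h \<psi>"
  using world_modal_axiom world_simps(5) residuum_eq_top_iff by metis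

lemma world_Box_mono:
  assumes "world Ax Ru h" "entails {} (\<phi> \<^bold>\<rightarrow> \<psi>)"
  shows "h (Box b \<phi>) \<le> h (Box b \<psi>)"
proof -
  have "mM_deriv Ax Ru {} (\<phi> \<^bold>\<rightarrow> \<psi>)"
    using mM_deriv_entails[OF ax assms(2)] by blast
  then have "h (Box b \<phi> \<^bold>\<rightarrow> Box b \<psi>) = top"
    by (blast intro: mM_deriv.mono world_theorem assms(1))
  then show ?thesis
    by (simp add: world_simps[OF assms(1)] residuum_eq_top_iff)
qed

text \<open>This turns a graded bound \<open>a \<le> h (Box b \<phi>)\<close> into a box of value
  \<open>top\<close>.\<close>

lemma world_Box_const:
  assumes "world Ax Ru h"
  shows "h (Box b (Const a \<^bold>\<rightarrow> \<phi>)) = a \<leadsto> h (Box b \<phi>)"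
  using world_modal_axiom[OF assms modal_axioms.box_const] world_simps[OF assms] by metis

text \<open>The coatom axiom replaces the missing deduction theorem: if \<open>\<chi>\<close> entails \<open>\<theta>\<close>, then
  \<open>\<chi> \<^bold>\<rightarrow> Const k \<^bold>\<or> \<theta>\<close> is a tautology.\<close>

lemma boxed_entails:
  assumes h: "world Ax Ru h" and "entails {\<chi>. h (Box b \<chi>) = top} \<theta>"
  shows "h (Box b \<theta>) = top"
proof (cases "\<exists>k :: 'b. coatom k")
  \<comment> \<open>Without a coatom every value is \<open>top\<close>.\<close>
  case False
  then show ?thesis
    using ex_coatom by blast
next
  case True
  then obtain k :: 'b where k: "coatom k" ..
  obtain \<Delta> where \<Delta>: "\<Delta> \<subseteq> {\<chi>. h (Box b \<chi>) = top}" "finite \<Delta>" "entails \<Delta> \<theta>"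
    using entails_compact assms(2) by blast
  \<comment> \<open>A single \<chi>, the conjunction of \<Delta>, can stand under the box.\<close>
  from \<Delta>(2,1) have "\<exists>\<chi>. h (Box b \<chi>) = top \<and> (\<forall>v. ext v \<chi> = top \<longrightarrow> (\<forall>\<delta>\<in>\<Delta>. ext v \<delta> = top))"
  proof (induction \<Delta>)
    case empty
    then show ?case
      using world_modal_axiom[OF h modal_axioms.box_one] by blast
  next
    case (insert \<delta> \<Delta>)
    then obtain \<chi> where \<chi>: "h (Box b \<chi>) = top" "\<forall>v. ext v \<chi> = top \<longrightarrow> (\<forall>\<delta>\<in>\<Delta>. ext v \<delta> = top)"
      by auto
    have "h (Box b \<delta> \<^bold>\<and> Box b \<chi>) \<le> h (Box b (\<delta> \<^bold>\<and> \<chi>))"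
      by (rule world_imp_axiom[OF h modal_axioms.box_and])
    then have "h (Box b (\<delta> \<^bold>\<and> \<chi>)) = top"
      using insert.prems \<chi>(1) by (simp add: world_simps[OF h] top_unique)
    then show ?case
      using \<chi>(2) by (intro exI[of _ "\<delta> \<^bold>\<and> \<chi>"]) (auto simp: inf_eq_top_iff)
  qed
  then obtain \<chi> where \<chi>: "h (Box b \<chi>) = top" "\<And>v. ext v \<chi> = top \<Longrightarrow> \<forall>\<delta>\<in>\<Delta>. ext v \<delta> = top"
    by blast
  have "entails {} (\<chi> \<^bold>\<rightarrow> Const k \<^bold>\<or> \<theta>)"
    using \<chi>(2) \<Delta>(3) by (simp add: entails_def residuum_eq_top_iff le_sup_coatom_iff[OF k])
  then have "h (Box b \<chi>) \<le> h (Box b (Const k \<^bold>\<or> \<theta>))"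
    by (rule world_Box_mono[OF h])
  also have "\<dots> \<le> h (Const k \<^bold>\<or> Box b \<theta>)"
    by (rule world_imp_axiom[OF h modal_axioms.box_coatom[OF k]])
  finally show ?thesis
    by (simp add: \<chi>(1) world_simps[OF h] le_sup_coatom_iff[OF k])
qed

section \<open>Accessibility between worlds\<close>

lemma acc_refl: "world Ax Ru h \<Longrightarrow> acc b h h"
  unfolding acc_def using world_imp_axiom[OF _ modal_axioms.box_T] by blast

lemma acc_antimono: "world Ax Ru h \<Longrightarrow> a \<le> b \<Longrightarrow> acc b h g \<Longrightarrow> acc a h g"
  unfolding acc_def using world_imp_axiom[OF _ modal_axioms.box_nested] order.trans by blast

lemma acc_trans: "world Ax Ru h \<Longrightarrow> acc a h g \<Longrightarrow> acc b g f \<Longrightarrow> acc (inf a b) h f"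
  unfolding acc_def using world_imp_axiom[OF _ modal_axioms.box_4] order.trans by metis

lemma acc_bot_sym:
  assumes h: "world Ax Ru h" and g: "world Ax Ru g" and "acc bot h g"
  shows "acc bot g h"
  unfolding acc_def
proof
  fix \<psi>
  \<comment> \<open>With this constant, \<open>?\<phi>\<close> has value \<open>top\<close> at
    \<open>h\<close>, so axiom B makes its diamond \<open>top\<close> at \<open>g\<close>; the
    conjunct for \<open>a\<close> gives the bound.\<close>
  define a where "a = h \<psi>"
  let ?\<phi> = "\<psi> \<^bold>\<rightarrow> Const a"
  have "top \<le> h ?\<phi>"
    by (simp add: world_simps[OF h] a_def residuum_eq_top_iff top_unique)
  also have "\<dots> \<le> h (Box bot (Dia bot ?\<phi>))"
    by (rule world_imp_axiom[OF h modal_axioms.box_B])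
  also have "\<dots> \<le> g (Dia bot ?\<phi>)"
    using \<open>acc bot h g\<close> by (simp add: acc_def)
  finally have "g (Box bot (?\<phi> \<^bold>\<rightarrow> Const a)) \<le> a"
    by (simp add: world_simps(7)[OF g] top_unique residuum_eq_top_iff)
  moreover have "entails {} (\<psi> \<^bold>\<rightarrow> ?\<phi> \<^bold>\<rightarrow> Const a)"
    by (simp add: entails_def residuum_eq_top_iff odot_residuum_le flip: residuation)
  then have "g (Box bot \<psi>) \<le> g (Box bot (?\<phi> \<^bold>\<rightarrow> Const a))"
    by (rule world_Box_mono[OF g])
  ultimately show "g (Box bot \<psi>) \<le> h \<psi>"
    by (simp add: a_def)
qed

section \<open>Truth lemma and canonical model\<close>

lemma world_Box_eq_Inf_fin:
  assumes h: "world Ax Ru h"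
  shows "h (Box b \<psi>) = Inf_fin ((\<lambda>g. g \<psi>) ` {g. world Ax Ru g \<and> acc b h g})"
    (is "_ = Inf_fin ?V")
proof (rule antisym)
  have ne: "?V \<noteq> {}"
    using h acc_refl by blast
  then show "h (Box b \<psi>) \<le> Inf_fin ?V"
    by (intro Inf_fin.boundedI) (auto simp: acc_def)
  let ?c = "Inf_fin ?V"
  have "entails {\<chi>. h (Box b \<chi>) = top} (Const ?c \<^bold>\<rightarrow> \<psi>)"
    unfolding entails_def
  proof (intro allI impI)
    fix v assume v: "\<forall>\<chi>\<in>{\<chi>. h (Box b \<chi>) = top}. ext v \<chi> = top"
    \<comment> \<open>By necessitation every theorem has a box of value \<open>top\<close> at
      \<open>h\<close>, so \<open>v\<close> satisfies it.\<close>
    have "world Ax Ru (ext v)"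
      using v mM_deriv.nec world_theorem[OF h] unfolding world_def by blast
    moreover have "acc b h (ext v)"
      unfolding acc_def
    proof
      fix \<chi>
      \<comment> \<open>The value of the box, used as a constant, makes the required inequality a
        formula that \<open>v\<close> must satisfy.\<close>
      have "h (Box b (Const (h (Box b \<chi>)) \<^bold>\<rightarrow> \<chi>)) = top"
        by (simp add: world_Box_const[OF h] residuum_eq_top_iff)
      then have "ext v (Const (h (Box b \<chi>)) \<^bold>\<rightarrow> \<chi>) = top"
        using v by blast
      then show "h (Box b \<chi>) \<le> ext v \<chi>"
        by (simp add: residuum_eq_top_iff)
    qed
    ultimately have "ext v \<psi> \<in> ?V"
      by blast
    then show "ext v (Const ?c \<^bold>\<rightarrow> \<psi>) = top"
      by (simp add: residuum_eq_top_iff Inf_fin.coboundedI)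
  qed
  then have "h (Box b (Const ?c \<^bold>\<rightarrow> \<psi>)) = top"
    by (rule boxed_entails[OF h])
  then show "?c \<le> h (Box b \<psi>)"
    by (simp add: world_Box_const[OF h] residuum_eq_top_iff)
qed

lemma le_canon_pref_iff:
  assumes "world Ax Ru h" "acc bot h g"
  shows "b \<le> canon_pref h g \<longleftrightarrow> acc b h g"
proof -
  have "acc (canon_pref h g) h g"
    unfolding canon_pref_def using Max_in[of "{b. acc b h g}"] assms(2) by auto
  then show ?thesis
    using acc_antimono[OF assms(1)] by (auto simp: canon_pref_def)
qed

lemma canonical_model:
  assumes h\<^sub>0: "world Ax Ru h\<^sub>0"
  defines "W \<equiv> {g. world Ax Ru g \<and> acc bot h\<^sub>0 g}"
  shows "preference_model W canon_pref"
    and "h \<in> W \<Longrightarrow> eval W canon_pref (\<lambda>h x. h (Var x)) \<phi> h = h \<phi>"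
proof -
  have world: "world Ax Ru g" if "g \<in> W" for g
    using that by (simp add: W_def)
  \<comment> \<open>Any two members are linked through \<open>h\<^sub>0\<close>, by symmetry and
    transitivity.\<close>
  have total: "acc bot g g'" if "g \<in> W" "g' \<in> W" for g g'
    using that acc_bot_sym[OF h\<^sub>0] acc_trans[of g bot h\<^sub>0 bot g'] by (auto simp: W_def)
  have le_pref: "b \<le> canon_pref g g' \<longleftrightarrow> acc b g g'" if "g \<in> W" "g' \<in> W" for b g g'
    using le_canon_pref_iff world total that by blast
  show "preference_model W canon_pref"
    unfolding preference_model_def
  proof (intro conjI ballI)
    show "W \<noteq> {}"
      using h\<^sub>0 acc_refl by (auto simp: W_def)
  next
    fix g assume "g \<in> W"
    then show "canon_pref g g = top"
      using le_pref[of g g top] acc_refl world top_unique by blast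
  next
    fix f g g' assume "f \<in> W" "g \<in> W" "g' \<in> W"
    then show "inf (canon_pref f g) (canon_pref g g') \<le> canon_pref f g'"
      using le_pref acc_trans[OF world] by (meson order.refl)
  qed
  show "h \<in> W \<Longrightarrow> eval W canon_pref (\<lambda>h x. h (Var x)) \<phi> h = h \<phi>"
  proof (induction \<phi> arbitrary: h)
    case (Box b \<phi>)
    \<comment> \<open>The restriction loses no successors, so the infimum over all worlds is
      unchanged.\<close>
    have "g \<in> W" if "world Ax Ru g" "acc b h g" for g
      using that acc_antimono[of h bot b g] acc_trans[OF h\<^sub>0, of bot h bot g] Box.prems
      by (auto simp: W_def)
    then have "{g \<in> W. b \<le> canon_pref h g} = {g. world Ax Ru g \<and> acc b h g}"
      using le_pref[OF Box.prems] world by blast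
    moreover have "eval W canon_pref (\<lambda>h x. h (Var x)) \<phi> ` {g \<in> W. b \<le> canon_pref h g} =
        (\<lambda>g. g \<phi>) ` {g \<in> W. b \<le> canon_pref h g}"
      using Box.IH by (intro image_cong) auto
    ultimately show ?case
      using world_Box_eq_Inf_fin[OF world[OF Box.prems]] by simp
  qed (simp_all add: world_simps[OF world])
qed

end

text \<open>Canonical worlds are valuations, so models over that type already refute whatever is not
  derivable; soundness holds over every type of worlds.\<close>

theorem theorem1:
  fixes Ax :: "'b::finite_mtl_chain pfm set"
    and Ru :: "('b pfm set \<times> 'b pfm) set"
    and \<Gamma> :: "('b, 'v) fm set"
    and \<phi> :: "('b, 'v) fm"
  assumes "prop_axiomatization Ax Ru"
  shows "(mM_deriv Ax Ru \<Gamma> \<phi> \<longleftrightarrow> pref_conseq TYPE(('b, 'v) fm \<Rightarrow> 'b) \<Gamma> \<phi>) \<and>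
         (mM_deriv Ax Ru \<Gamma> \<phi> \<longrightarrow> pref_conseq TYPE('w) \<Gamma> \<phi>)"
proof (intro conjI impI iffI)
  assume "mM_deriv Ax Ru \<Gamma> \<phi>"
  note sound = mM_deriv_sound[OF assms this]
  show "pref_conseq TYPE(('b, 'v) fm \<Rightarrow> 'b) \<Gamma> \<phi>" "pref_conseq TYPE('w) \<Gamma> \<phi>"
    unfolding pref_conseq_def by (blast intro: sound)+
next
  assume conseq: "pref_conseq TYPE(('b, 'v) fm \<Rightarrow> 'b) \<Gamma> \<phi>"
  show "mM_deriv Ax Ru \<Gamma> \<phi>"
  proof (rule all_worlds_imp_mM_deriv[OF assms])
    fix h :: "('b, 'v) fm \<Rightarrow> 'b"
    assume h: "world Ax Ru h" "\<forall>\<gamma>\<in>\<Gamma>. h \<gamma> = top"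
    let ?W = "{g. world Ax Ru g \<and> acc bot h g}"
    have hW: "h \<in> ?W"
      using h(1) acc_refl[OF assms] by blast
    note truth = canonical_model(2)[OF assms h(1) hW]
    have "eval ?W canon_pref (\<lambda>h x. h (Var x)) \<phi> h = top"
      by (rule conseq[unfolded pref_conseq_def, rule_format, OF canonical_model(1)[OF assms h(1)] hW])
        (simp add: truth h(2))
    then show "h \<phi> = top"
      by (simp add: truth)
  qed
qed

end
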